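(* Let $n \ge 1$ be an integer and let $N_n$ be the weighted planar network with sources $a_1,\dots,a_n$ and sinks $b_1,\dots,b_n$ described in the context. Then for all integers $m,k$ with $1 \le m,k \le n$, the sum of the weights of all directed paths in $N_n$ from $a_m$ to $b_k$ is equal to the Lah number $L_{m,k}$.
   Context: Lah numbers: for $m,k\in\mathbb{N}_0$, $L_{m,k}$ is the number of ways to partition the set $[m]=\{1,2,\dots,m\}$ into $k$ nonempty tuples, i.e. the number of (unordered) partitions of $[m]$ into $k$ nonempty blocks, each block being equipped with a linear order. By convention $L_{0,0}=1$. The network $N_n$: it is a directed acyclic graph with weighted edges. Vertices: for each level $i\in\{1,\dots,n\}$ there are grid vertices $v_{i,c}$ for $n-i+1\le c\le n$, and a source $a_i$. For $i<n$ the source $a_i$ is an additional vertex, distinct from all the others; for $i=n$ one sets $a_n=v_{n,1}$. The sinks are $b_i=v_{i,n}$ for $1\le i\le n$. Edges: (1) for each $i<n$, a horizontal edge $a_i\to v_{i,n-i+1}$ of weight $1$; (2) for each $1\le i\le n$ and each $n-i+1\le c\le n-1$, a horizontal edge $v_{i,c}\to v_{i,c+1}$ of weight $1$; (3) for each $2\le i\le n$ and each $n-i+1\le c\le n-1$, a diagonal edge $v_{i,c}\to v_{i-1,c+1}$ of weight $i$. There are no other edges. The weight of a directed path is the product of the weights of its edges (a path with no edges has weight $1$). An empty sum is $0$. *)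

theory Defs
  imports "Graph_Theory.Pair_Digraph" "HOL-Library.Disjoint_Sets"
begin

text \<open>
  A tuple is a distinct list, and its block is the set of its entries. Injectivity of \<^const>\<open>set\<close>
  rules out two tuples ordering the same block; blocks of a partition are nonempty by
  \<^const>\<open>partition_on\<close>.
\<close>

definition lah :: "nat \<Rightarrow> nat \<Rightarrow> nat" where
  "lah m k = card {P :: nat list set.
     (\<forall>xs\<in>P. distinct xs) \<and> inj_on set P \<and> partition_on {1..m} (set ` P) \<and> card P = k}"

lemma lah_0_0: "lah 0 0 = 1"
proof -
  have "{P :: nat list set. (\<forall>xs\<in>P. distinct xs) \<and> inj_on set P \<and>
      partition_on {1..0} (set ` P) \<and> card P = 0} = {{}}"
    by (auto simp: partition_on_def)
  then show ?thesis by (simp add: lah_def)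
qed

datatype vertex = Src nat | Grid nat nat

text \<open>\<open>Grid i c\<close> is the vertex of level \<open>i\<close> in column \<open>c\<close>.\<close>

definition source :: "nat \<Rightarrow> nat \<Rightarrow> vertex" where
  "source n i = (if i = n then Grid n 1 else Src i)"

definition sink :: "nat \<Rightarrow> nat \<Rightarrow> vertex" where
  "sink n i = Grid i n"

definition network :: "nat \<Rightarrow> vertex pair_pre_digraph" where
  "network n = \<lparr>
     pverts = {source n i | i. 1 \<le> i \<and> i \<le> n}
            \<union> {Grid i c | i c. 1 \<le> i \<and> i \<le> n \<and> n - i + 1 \<le> c \<and> c \<le> n},
     parcs = {(source n i, Grid i (n - i + 1)) | i. 1 \<le> i \<and> i < n}
           \<union> {(Grid i c, Grid i (c + 1)) | i c. 1 \<le> i \<and> i \<le> n \<and> n - i + 1 \<le> c \<and> c < n}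
           \<union> {(Grid i c, Grid (i - 1) (c + 1)) | i c. 2 \<le> i \<and> i \<le> n \<and> n - i + 1 \<le> c \<and> c < n}\<rparr>"

text \<open>On edges of the network, the tail and head of an edge lie on different levels exactly if the
  edge is diagonal. The values on other pairs of vertices are irrelevant.\<close>

fun edge_weight :: "vertex \<times> vertex \<Rightarrow> nat" where
  "edge_weight (Grid i c, Grid j d) = (if j = i then 1 else i)"
| "edge_weight _ = 1"

definition path_weight :: "(vertex \<times> vertex) list \<Rightarrow> nat" where
  "path_weight p = (\<Prod>e\<leftarrow>p. edge_weight e)"

definition paths :: "nat \<Rightarrow> vertex \<Rightarrow> vertex \<Rightarrow> (vertex \<times> vertex) list set" where
  "paths n u v = {p. pre_digraph.apath (with_proj (network n)) u p v}"

lemma network_pair_fin_digraph: "pair_fin_digraph (network n)"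
proof
  have "pverts (network n) \<subseteq> source n ` {..n} \<union> (\<lambda>(i, c). Grid i c) ` ({..n} \<times> {..n})"
    by (auto simp: network_def)
  then show fin: "finite (pverts (network n))"
    by (rule finite_subset) auto
  show wf: "fst e \<in> pverts (network n)" "snd e \<in> pverts (network n)"
    if "e \<in> parcs (network n)" for e
    using that by (auto simp: network_def)
  have "parcs (network n) \<subseteq> pverts (network n) \<times> pverts (network n)"
    using wf by (auto simp: mem_Times_iff)
  then show "finite (parcs (network n))"
    by (rule finite_subset) (use fin in auto)
qed

lemma finite_paths: "finite (paths n u v)"
proof -
  interpret pair_fin_digraph "network n" by (rule network_pair_fin_digraph)
  show ?thesis unfolding paths_def by (rule apaths_finite)
qed

lemma network_acyclic: "acyclic (parcs (network n))"
proof -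
  define f where "f = (\<lambda>v. case v of Src _ \<Rightarrow> 0 | Grid _ c \<Rightarrow> c)"
  have "parcs (network n) \<subseteq> measure f"
    by (auto simp: network_def source_def f_def)
  then show ?thesis
    by (meson acyclic_subset wf_acyclic wf_measure)
qed

end

theory Submission
  imports Defs "HOL-Combinatorics.Multiset_Permutations"
begin

text \<open>
  Both sides are given by the same closed formula: for \<open>1 \<le> k \<le> m\<close>,
  the number \<open>k! \<cdot> L\<^sub>m\<^sub>,\<^sub>k\<close> and \<open>k!\<close> times the path sum
  are equal to \<open>m! \<cdot> (m - 1 choose m - k)\<close>, while for \<open>k > m\<close> both sides vanish.

  For the network: a path from \<open>a\<^sub>m\<close> that ends in the last column enters the grid at level \<open>m\<close>
  and then makes exactly \<open>m - 1\<close> steps to the right, each of which either keeps the level or lowers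
  it by one. To finish at level \<open>k\<close>, it must choose which \<open>m - k\<close> of these steps are diagonal, and
  whatever the choice, the diagonals have the weights \<open>m, m - 1, \<dots>, k + 1\<close>, with product
  \<open>m! / k!\<close>. Rather than classifying paths by their diagonal steps, the proof
  splits off the first edge (\<open>path_sum_step\<close>), which turns the count into Pascal's rule
  (\<open>path_sum_grid\<close>).

  For the Lah numbers: a partition of \<open>[m]\<close> into \<open>k\<close> tuples, together with one of the \<open>k!\<close> orders
  of its tuples, is a list of \<open>k\<close> nonempty lists whose concatenation is a permutation of \<open>[m]\<close>
  (\<open>card_ordered_blocks_lah\<close>). Such a list of lists is in turn determined by this permutation and by
  the list of block lengths, which is an arbitrary composition of \<open>m\<close> into \<open>k\<close> positive parts
  (\<open>bij_betw_ordered_blocks\<close>). There are \<open>m!\<close> permutations and \<open>m - 1 choose m - k\<close> compositions.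
\<close>

section \<open>Path sums in the network\<close>

definition path_sum :: "nat \<Rightarrow> vertex \<Rightarrow> vertex \<Rightarrow> nat" where
  "path_sum n u v = (\<Sum>p\<in>paths n u v. path_weight p)"

text \<open>
  Since the network is acyclic, a path from the head of an edge never returns to its tail, so
  putting the edge in front cannot make a vertex occur twice.
\<close>

lemma Cons_in_paths_iff:
  "e # p \<in> paths n u v \<longleftrightarrow> e \<in> parcs (network n) \<and> fst e = u \<and> p \<in> paths n (snd e) v"
proof -
  interpret pair_fin_digraph "network n" by (rule network_pair_fin_digraph)
  have "fst e \<notin> set (awalk_verts (snd e) p)" if e: "e \<in> parcs (network n)" and p: "apath (snd e) p v"
  proof
    assume "fst e \<in> set (awalk_verts (snd e) p)"
    then have "snd e \<rightarrow>\<^sup>*\<^bsub>with_proj (network n)\<^esub> fst e"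
      by (rule awalk_verts_reachable_from[OF awalkI_apath[OF p]])
    then have "(snd e, fst e) \<in> (parcs (network n))\<^sup>*"
      by (auto dest: reachable_rtranclI)
    moreover have "(fst e, snd e) \<in> parcs (network n)"
      using e by simp
    ultimately show False
      using network_acyclic[of n] by (meson acyclic_def rtrancl_into_trancl2)
  qed
  then show ?thesis
    unfolding paths_def by (auto simp: apath_Cons_iff)
qed

lemma Nil_in_paths_iff: "[] \<in> paths n u v \<longleftrightarrow> u = v \<and> u \<in> pverts (network n)"
proof -
  interpret pair_fin_digraph "network n" by (rule network_pair_fin_digraph)
  show ?thesis unfolding paths_def by (auto simp: apath_Nil_iff)
qed

lemma path_sum_step:
  "path_sum n u v = (if u = v \<and> u \<in> pverts (network n) then 1 else 0) +
     (\<Sum>w | (u, w) \<in> parcs (network n). edge_weight (u, w) * path_sum n w v)"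
proof -
  define S where "S = {w. (u, w) \<in> parcs (network n)}"
  define A where "A = {p \<in> paths n u v. p = []}"
  define B where "B = (\<Union>w\<in>S. Cons (u, w) ` paths n w v)"
  interpret pair_fin_digraph "network n" by (rule network_pair_fin_digraph)
  have finS: "finite S"
    by (rule finite_subset[of _ "snd ` parcs (network n)"]) (force simp: S_def)+
  have finB: "finite B"
    unfolding B_def using finS by (auto intro: finite_paths)
  have finA: "finite A" and disj: "A \<inter> B = {}"
    by (auto simp: A_def B_def finite_paths)
  have split: "paths n u v = A \<union> B"
  proof (rule set_eqI)
    fix p show "p \<in> paths n u v \<longleftrightarrow> p \<in> A \<union> B"
      by (cases p) (auto simp: A_def B_def S_def Cons_in_paths_iff)
  qed
  have "path_sum n u v = sum path_weight A + sum path_weight B"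
    unfolding path_sum_def split by (rule sum.union_disjoint[OF finA finB disj])
  also have "sum path_weight A = (if u = v \<and> u \<in> pverts (network n) then 1 else 0)"
  proof -
    have "A = (if u = v \<and> u \<in> pverts (network n) then {[]} else {})"
      by (auto simp: A_def Nil_in_paths_iff)
    then show ?thesis
      by (auto simp: path_weight_def)
  qed
  also have "sum path_weight B = (\<Sum>w\<in>S. \<Sum>p\<in>Cons (u, w) ` paths n w v. path_weight p)"
    unfolding B_def by (rule sum.UNION_disjoint) (auto simp: finS finite_paths)
  also have "\<dots> = (\<Sum>w\<in>S. edge_weight (u, w) * path_sum n w v)"
    by (simp add: sum.reindex path_sum_def sum_distrib_left path_weight_def)
  finally show ?thesis
    by (simp add: S_def)
qed

text \<open>
  With \<open>d\<close> columns left to the sinks, Pascal's rule is the choice between the horizontal and the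
  diagonal edge. The hypothesis \<open>d < i\<close> says that the vertex belongs to the grid; at level
  \<open>1\<close> it leaves \<open>d = 0\<close>, so that every vertex before the last column has both outgoing edges.
\<close>

lemma path_sum_grid:
  assumes "d < i" "i \<le> n" "1 \<le> k"
  shows "fact k * path_sum n (Grid i (n - d)) (sink n k) =
    (if k \<le> i then fact i * (d choose (i - k)) else 0)"
  using assms
proof (induction d arbitrary: i)
  case 0
  have "{w. (Grid i n, w) \<in> parcs (network n)} = {}"
    using 0 by (auto simp: network_def source_def)
  moreover have "Grid i n \<in> pverts (network n)"
    using 0 by (auto simp: network_def)
  ultimately show ?case
    by (subst path_sum_step) (auto simp: sink_def)
next
  case (Suc d)
  let ?c = "n - Suc d"
  have c: "?c + 1 = n - d"
    using Suc.prems by simp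
  have "{w. (Grid i ?c, w) \<in> parcs (network n)} = {Grid i (n - d), Grid (i - 1) (n - d)}"
    using Suc.prems c by (auto simp: network_def source_def)
  moreover have "Grid i ?c \<noteq> sink n k"
    using Suc.prems by (auto simp: sink_def)
  moreover have "Grid i (n - d) \<noteq> Grid (i - 1) (n - d)"
    using Suc.prems by simp
  ultimately have "path_sum n (Grid i ?c) (sink n k) =
      path_sum n (Grid i (n - d)) (sink n k) + i * path_sum n (Grid (i - 1) (n - d)) (sink n k)"
    using Suc.prems by (subst path_sum_step) auto
  then have "fact k * path_sum n (Grid i ?c) (sink n k) =
      fact k * path_sum n (Grid i (n - d)) (sink n k) +
      i * (fact k * path_sum n (Grid (i - 1) (n - d)) (sink n k))"
    by (simp add: algebra_simps)
  also have "\<dots> = (if k \<le> i then fact i * (d choose (i - k)) else 0) +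
      i * (if k \<le> i - 1 then fact (i - 1) * (d choose (i - 1 - k)) else 0)"
    using Suc.IH[of i] Suc.IH[of "i - 1"] Suc.prems by simp
  also have "\<dots> = (if k \<le> i then fact i * (Suc d choose (i - k)) else 0)"
  proof (cases "k < i")
    case True
    then have "i - k = Suc (i - 1 - k)"
      by simp
    moreover have "fact i = i * fact (i - 1)"
      using True by (simp add: fact_reduce)
    ultimately show ?thesis
      using True by (simp add: algebra_simps)
  qed (use Suc.prems in auto)
  finally show ?case .
qed

text \<open>
  For \<open>m = n\<close> the source already is the first grid vertex of its level; otherwise a single edge of
  weight \<open>1\<close> leads there.
\<close>

lemma path_sum_source:
  assumes "1 \<le> m" "m \<le> n"
  shows "path_sum n (source n m) (sink n k) = path_sum n (Grid m (n - m + 1)) (sink n k)"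
proof (cases "m = n")
  case False
  have "{w. (Src m, w) \<in> parcs (network n)} = {Grid m (n - m + 1)}"
  proof (intro equalityI subsetI)
    fix w assume "w \<in> {w. (Src m, w) \<in> parcs (network n)}"
    then show "w \<in> {Grid m (n - m + 1)}"
      by (auto simp: network_def source_def split: if_splits)
  next
    fix w assume "w \<in> {Grid m (n - m + 1)}"
    moreover have "(source n m, Grid m (n - m + 1)) \<in> parcs (network n)"
      unfolding network_def using assms False by simp
    ultimately show "w \<in> {w. (Src m, w) \<in> parcs (network n)}"
      using False by (simp add: source_def)
  qed
  then show ?thesis
    using False by (subst path_sum_step) (simp add: source_def sink_def)
qed (simp add: source_def)

section \<open>Ordered lists of blocks\<close>

definition ordered_blocks :: "'a set \<Rightarrow> nat \<Rightarrow> 'a list list set" where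
  "ordered_blocks A k = {Q. length Q = k \<and> [] \<notin> set Q \<and> concat Q \<in> permutations_of_set A}"

definition compositions :: "nat \<Rightarrow> nat \<Rightarrow> nat list set" where
  "compositions m k = {ls. length ls = k \<and> sum_list ls = m \<and> 0 \<notin> set ls}"

text \<open>Subtracting \<open>1\<close> from every part gives lists of \<open>k\<close> natural numbers with sum \<open>m - k\<close>,
  which stars and bars count.\<close>

lemma card_compositions:
  "card (compositions m k) = (if k \<le> m then (m - 1) choose (m - k) else 0)"
proof -
  have sum_Suc: "sum_list (map Suc ls) = sum_list ls + length ls" for ls
    by (induction ls) auto
  have pred: "map Suc (map (\<lambda>l. l - 1) ls) = ls" if "0 \<notin> set ls" for ls
    using that by (induction ls) auto
  have shift: "compositions m k = map Suc ` {ls. length ls = k \<and> sum_list ls + k = m}"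
  proof (intro set_eqI iffI)
    fix ls assume ls: "ls \<in> compositions m k"
    then have "map Suc (map (\<lambda>l. l - 1) ls) = ls"
      by (intro pred) (simp add: compositions_def)
    moreover from this have "sum_list (map (\<lambda>l. l - 1) ls) + k = m"
      using ls sum_Suc[of "map (\<lambda>l. l - 1) ls"] by (simp add: compositions_def)
    ultimately show "ls \<in> map Suc ` {ls. length ls = k \<and> sum_list ls + k = m}"
      using ls by (intro image_eqI[of _ _ "map (\<lambda>l. l - 1) ls"]) (auto simp: compositions_def)
  qed (auto simp: compositions_def sum_Suc)
  show ?thesis
  proof (cases "k \<le> m")
    case True
    then have "compositions m k = map Suc ` {ls. length ls = k \<and> sum_list ls = m - k}"
      unfolding shift by (intro arg_cong[where f = "image (map Suc)"]) auto
    then have "card (compositions m k) = card {ls::nat list. length ls = k \<and> sum_list ls = m - k}"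
      using inj_on_subset[OF inj_mapI[OF inj_Suc]] by (simp add: card_image)
    also have "\<dots> = (m - 1) choose (m - k)"
      using True by (simp add: card_length_sum_list)
    finally show ?thesis
      using True by simp
  qed (auto simp: shift)
qed

lemma ex_concat_map_length:
  "sum_list ls = length xs \<Longrightarrow> \<exists>Q. concat Q = xs \<and> map length Q = ls"
proof (induction ls arbitrary: xs)
  case (Cons l ls)
  have "sum_list ls = length (drop l xs)"
    using Cons.prems by auto
  then obtain Q where "concat Q = drop l xs" "map length Q = ls"
    using Cons.IH by blast
  then show ?case
    using Cons.prems by (intro exI[of _ "take l xs # Q"]) auto
qed simp

text \<open>A list of blocks is a list that is cut at prescribed places.\<close>

lemma bij_betw_ordered_blocks:
  "bij_betw (\<lambda>Q. (concat Q, map length Q)) (ordered_blocks A k)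
     (permutations_of_set A \<times> compositions (card A) k)"
proof (rule bij_betw_imageI)
  show "inj_on (\<lambda>Q. (concat Q, map length Q)) (ordered_blocks A k)"
  proof (rule inj_onI, elim Pair_inject)
    fix Q R :: "'a list list"
    assume "concat Q = concat R" and len: "map length Q = map length R"
    moreover from len have "length Q = length R"
      by (rule map_eq_imp_length_eq)
    moreover from len have "\<forall>(x, y)\<in>set (zip Q R). length x = length y"
      by (auto simp: in_set_zip dest: map_eq_imp_length_eq) (metis nth_map)
    ultimately show "Q = R"
      by (intro concat_injective)
  qed
  show "(\<lambda>Q. (concat Q, map length Q)) ` ordered_blocks A k =
      permutations_of_set A \<times> compositions (card A) k"
  proof (intro equalityI subsetI)
    fix z assume "z \<in> permutations_of_set A \<times> compositions (card A) k"
    then obtain xs ls where z: "z = (xs, ls)" "xs \<in> permutations_of_set A" "ls \<in> compositions (card A) k"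
      by blast
    then have "sum_list ls = length xs"
      by (simp add: compositions_def length_finite_permutations_of_set)
    then obtain Q where Q: "concat Q = xs" "map length Q = ls"
      using ex_concat_map_length by blast
    then have "Q \<in> ordered_blocks A k"
      using z by (force simp: ordered_blocks_def compositions_def)
    then show "z \<in> (\<lambda>Q. (concat Q, map length Q)) ` ordered_blocks A k"
      using Q z by force
  qed (auto simp: ordered_blocks_def compositions_def length_finite_permutations_of_set
        simp flip: length_concat)
qed

lemma card_ordered_blocks:
  assumes "finite A"
  shows "card (ordered_blocks A k) = fact (card A) * card (compositions (card A) k)"
  using bij_betw_same_card[OF bij_betw_ordered_blocks[of A k]] assms
  by (simp add: card_cartesian_product)

section \<open>Lah numbers\<close>

definition lah_partitions :: "'a set \<Rightarrow> nat \<Rightarrow> 'a list set set" where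
  "lah_partitions A k = {P.
     (\<forall>xs\<in>P. distinct xs) \<and> inj_on set P \<and> partition_on A (set ` P) \<and> card P = k}"

lemma lah_eq_card_lah_partitions: "lah m k = card (lah_partitions {1..m} k)"
  by (simp add: lah_def lah_partitions_def)

lemma finite_lah_partitions:
  assumes "finite A"
  shows "finite (lah_partitions A k)"
proof (rule finite_subset)
  show "lah_partitions A k \<subseteq> Pow {xs. set xs \<subseteq> A \<and> distinct xs}"
    by (auto simp: lah_partitions_def partition_on_def)
  show "finite (Pow {xs. set xs \<subseteq> A \<and> distinct xs})"
    using assms by (simp add: finite_subset_distinct)
qed

lemma finite_if_in_lah_partitions:
  assumes "finite A" "P \<in> lah_partitions A k"
  shows "finite P"
  using assms finite_elements[of A "set ` P"]
  by (auto simp: lah_partitions_def dest: finite_imageD)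

text \<open>
  The blocks are nonempty and pairwise disjoint, hence pairwise distinct, both as lists and as sets.
  So distinctness of the concatenation is the same as distinctness of the list of blocks together
  with the conditions on the set of its entries.
\<close>

lemma ordered_blocks_iff:
  "Q \<in> ordered_blocks A k \<longleftrightarrow> distinct Q \<and> set Q \<in> lah_partitions A k"
proof
  assume Q: "Q \<in> ordered_blocks A k"
  then have ne: "[] \<notin> set Q" and d: "distinct (concat Q)"
    by (auto simp: ordered_blocks_def permutations_of_set_def)
  have dQ: "distinct Q"
    using d ne by (simp add: distinct_concat_iff)
  have disj: "set ys \<inter> set zs = {}" if "ys \<in> set Q" "zs \<in> set Q" "ys \<noteq> zs" for ys zs
    using d that unfolding distinct_concat_iff by blast
  have "inj_on set (set Q)"
    using disj ne by (intro inj_onI) fastforce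
  moreover have "partition_on A (set ` set Q)"
    using disj ne Q
    by (fastforce simp: partition_on_def disjoint_def ordered_blocks_def permutations_of_set_def)
  moreover have "\<forall>xs\<in>set Q. distinct xs"
    using d by (simp add: distinct_concat_iff)
  ultimately show "distinct Q \<and> set Q \<in> lah_partitions A k"
    using Q dQ by (simp add: lah_partitions_def ordered_blocks_def distinct_card)
next
  assume Q: "distinct Q \<and> set Q \<in> lah_partitions A k"
  then have inj: "inj_on set (set Q)" and part: "partition_on A (set ` set Q)"
    by (auto simp: lah_partitions_def)
  have "set ys \<inter> set zs = {}" if "ys \<in> set Q" "zs \<in> set Q" "ys \<noteq> zs" for ys zs
  proof -
    have "set ys \<noteq> set zs"
      using inj that by (meson inj_onD)
    then show ?thesis
      using part that by (auto simp: partition_on_def disjoint_def)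
  qed
  moreover have "[] \<notin> set Q"
    using part by (auto simp: partition_on_def)
  ultimately show "Q \<in> ordered_blocks A k"
    using Q part
    by (auto simp: ordered_blocks_def permutations_of_set_def distinct_concat_iff distinct_removeAll
        lah_partitions_def partition_on_def distinct_card)
qed

text \<open>The \<open>k!\<close> orders of the tuples of one partition form a fibre of \<^const>\<open>set\<close>.\<close>

lemma card_ordered_blocks_lah:
  assumes "finite A"
  shows "card (ordered_blocks A k) = fact k * card (lah_partitions A k)"
proof -
  have "ordered_blocks A k = (\<Union>P\<in>lah_partitions A k. permutations_of_set P)"
    by (auto simp: ordered_blocks_iff permutations_of_set_def)
  then have "card (ordered_blocks A k) = (\<Sum>P\<in>lah_partitions A k. card (permutations_of_set P))"
    by (simp only:, intro card_UN_disjoint)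
      (auto simp: finite_lah_partitions[OF assms] dest: permutations_of_setD)
  also have "\<dots> = (\<Sum>P\<in>lah_partitions A k. fact k)"
  proof (rule sum.cong)
    fix P assume P: "P \<in> lah_partitions A k"
    then show "card (permutations_of_set P) = fact k"
      using finite_if_in_lah_partitions[OF assms P] by (simp add: lah_partitions_def)
  qed simp
  finally show ?thesis
    by simp
qed

lemma lah_closed_form:
  "fact k * lah m k = (if k \<le> m then fact m * ((m - 1) choose (m - k)) else 0)"
proof -
  have "fact k * lah m k = card (ordered_blocks {1..m} k)"
    unfolding lah_eq_card_lah_partitions by (simp only: card_ordered_blocks_lah finite_atLeastAtMost)
  also have "\<dots> = fact m * card (compositions m k)"
    by (simp add: card_ordered_blocks)
  finally show ?thesis
    by (simp add: card_compositions)
qed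

theorem theorem1:
  fixes n m k :: nat
  assumes "1 \<le> n"
    and "1 \<le> m" "m \<le> n"
    and "1 \<le> k" "k \<le> n"
  shows "(\<Sum>p \<in> paths n (source n m) (sink n k). path_weight p) = lah m k"
proof -
  have "n - (m - 1) = n - m + 1"
    using assms by simp
  then have "fact k * path_sum n (source n m) (sink n k) =
      (if k \<le> m then fact m * ((m - 1) choose (m - k)) else 0)"
    using path_sum_grid[of "m - 1" m n k] path_sum_source[of m n k] assms by simp
  also have "\<dots> = fact k * lah m k"
    by (simp add: lah_closed_form)
  finally show ?thesis
    by (simp add: path_sum_def)
qed

end
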